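(* Let $P_\infty$ be the law of $(U,\Theta)$ and $P_t$ the conditional law of $(\widetilde U,\widetilde\Theta)$ given $\tau(Y,X)>t$ (see context), and let $t_n\to\infty$. Let $(U_i,\Theta_i)$, $i=1,2,\dots$, be iid from $P_\infty$ and, for each $n$, let $(\widetilde U_i,\widetilde\Theta_i)$, $i=1,2,\dots$, be iid from $P_{t_n}$. If the random integer sequence $K(n)$ is independent from these samples and such that $$K(n)\stackrel{\mathbb P}{\to}\infty\quad\text{and}\quad K(n)\,\|P_{t_n}-P_\infty\|_{\rm TV}\stackrel{\mathbb P}{\longrightarrow}0,\quad n\to\infty,$$ then for any measurable $T_k=T_k((U_1,\Theta_1),\dots,(U_k,\Theta_k))$ such that $T_k\stackrel{\mathbb P}{\to}0$ as $k\to\infty$, we have $$\widetilde T_{K(n)}:=T_{K(n)}\big((\widetilde U_1,\widetilde\Theta_1),\dots,(\widetilde U_{K(n)},\widetilde\Theta_{K(n)})\big)\stackrel{\mathbb P}{\to}0,\quad n\to\infty.$$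
   Context: $(Y,X)$ is a random vector in $[0,\infty)\times\mathbb R^d$, $\tau(y,x)=y+\|x\|_1$ with $\|\cdot\|_1$ the $\ell_1$-norm, $\widetilde U=Y/(Y+\|X\|_1)$, $\widetilde\Theta=X/\|X\|_1$. $(Y,X)$ is jointly regularly varying: for some positive sequence $a_n$, $n\mathbb P[\tau(Y,X)>ta_n]\to t^{-1}$ for all $t>0$, and the conditional law of $(\widetilde U,(1-\widetilde U)\widetilde\Theta)=(Y,X)/\tau(Y,X)$ given $\tau(Y,X)>t$ converges as $t\to\infty$, in total variation, to the law of $(U,(1-U)\Theta)$, where $U\in[0,1]$, $\|\Theta\|_1=1$, $\mathbb P[U=0]<1$, $\mathbb P[U=1]<1$. Standing assumption: the law of $(U,\Theta)$ is $f_{U|\Theta}(u|\theta)\,du\,p_\Theta(d\theta)$ with $f_{U|\Theta}>0$ for almost all $(u,\theta)$ modulo $du\,p_\Theta(d\theta)$. $\|\cdot\|_{\rm TV}$ is the total variation norm. *)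

theory Defs
  imports "HOL-Probability.Probability"
begin

definition l1_norm :: "real ^ 'd \<Rightarrow> real" where
  "l1_norm x = (\<Sum>i\<in>UNIV. \<bar>x $ i\<bar>)"

definition tau :: "real \<Rightarrow> real ^ 'd \<Rightarrow> real" where
  "tau y x = y + l1_norm x"

text \<open>The two quotients below have the value 0 where their denominator is 0. In \<open>U_tilde\<close> this only
  happens outside the events \<open>tau y x > t\<close>, \<open>t \<ge> 0\<close>; in \<open>Theta_tilde\<close> it happens exactly for
  \<open>x = 0\<close>, where the direction is otherwise undefined.\<close>

definition U_tilde :: "real \<Rightarrow> real ^ 'd \<Rightarrow> real" where
  "U_tilde y x = y / (y + l1_norm x)"

definition Theta_tilde :: "real ^ 'd \<Rightarrow> real ^ 'd" where
  "Theta_tilde x = x /\<^sub>R l1_norm x"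

definition cond_law :: "'a measure \<Rightarrow> 'a set \<Rightarrow> ('a \<Rightarrow> 'b::topological_space) \<Rightarrow> 'b measure" where
  "cond_law M E Z = distr (uniform_measure M E) borel Z"

text \<open>The total variation norm of \<open>P - Q\<close>, for probability measures \<open>P\<close>, \<open>Q\<close> on the same
  \<open>\<sigma>\<close>-algebra, with the normalisation in which mutually singular measures are at distance 1.\<close>

definition tv_norm :: "'a measure \<Rightarrow> 'a measure \<Rightarrow> real" where
  "tv_norm P Q = (SUP A\<in>sets P. \<bar>measure P A - measure Q A\<bar>)"

definition conv_in_prob ::
  "'a measure \<Rightarrow> (nat \<Rightarrow> 'a \<Rightarrow> 'b::metric_space) \<Rightarrow> 'b \<Rightarrow> bool" where
  "conv_in_prob S Z c \<longleftrightarrow>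
     (\<forall>e>0. (\<lambda>n. measure S {\<omega> \<in> space S. dist (Z n \<omega>) c > e}) \<longlonglongrightarrow> 0)"

definition infinity_in_prob :: "'a measure \<Rightarrow> (nat \<Rightarrow> 'a \<Rightarrow> nat) \<Rightarrow> bool" where
  "infinity_in_prob S K \<longleftrightarrow>
     (\<forall>m. (\<lambda>n. measure S {\<omega> \<in> space S. K n \<omega> \<ge> m}) \<longlonglongrightarrow> 1)"

definition iid_from ::
  "'a measure \<Rightarrow> 'b::topological_space measure \<Rightarrow> (nat \<Rightarrow> 'a \<Rightarrow> 'b) \<Rightarrow> bool" where
  "iid_from S P V \<longleftrightarrow>
     prob_space.indep_vars S (\<lambda>_. borel) V UNIV \<and> (\<forall>i. distr S borel (V i) = P)"

text \<open>The library's \<open>indep_var\<close> forces both variables to take values in the same type, hence the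
  formulation through the generated \<open>\<sigma>\<close>-algebras.\<close>

definition indep_rv ::
  "'a measure \<Rightarrow> 'b measure \<Rightarrow> ('a \<Rightarrow> 'b) \<Rightarrow> 'c measure \<Rightarrow> ('a \<Rightarrow> 'c) \<Rightarrow> bool" where
  "indep_rv S N Z N' Z' \<longleftrightarrow>
     Z \<in> measurable S N \<and> Z' \<in> measurable S N' \<and>
     prob_space.indep_set S
       (sets (vimage_algebra (space S) Z N)) (sets (vimage_algebra (space S) Z' N'))"

text \<open>Joint regular variation of \<open>(Y, X)\<close> (on \<open>M\<close>) with limit \<open>(U, \<Theta>)\<close> (on \<open>N\<close>).\<close>

definition jointly_regularly_varying ::
  "'a measure \<Rightarrow> ('a \<Rightarrow> real) \<Rightarrow> ('a \<Rightarrow> real ^ 'd) \<Rightarrow>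
   'b measure \<Rightarrow> ('b \<Rightarrow> real) \<Rightarrow> ('b \<Rightarrow> real ^ 'd) \<Rightarrow> bool" where
  "jointly_regularly_varying M Y X N U \<Theta> \<longleftrightarrow>
     (\<exists>a::nat \<Rightarrow> real. (\<forall>n. a n > 0) \<and>
        (\<forall>t>0. (\<lambda>n. real n * measure M {\<omega> \<in> space M. tau (Y \<omega>) (X \<omega>) > t * a n})
                 \<longlonglongrightarrow> 1 / t)) \<and>
     ((\<lambda>t. tv_norm
         (cond_law M {\<omega> \<in> space M. tau (Y \<omega>) (X \<omega>) > t}
            (\<lambda>\<omega>. (U_tilde (Y \<omega>) (X \<omega>),
                  (1 - U_tilde (Y \<omega>) (X \<omega>)) *\<^sub>R Theta_tilde (X \<omega>))))
         (distr N borel (\<lambda>\<omega>. (U \<omega>, (1 - U \<omega>) *\<^sub>R \<Theta> \<omega>)))) \<longlongrightarrow> 0) at_top \<and>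
     (\<forall>\<omega>\<in>space N. 0 \<le> U \<omega> \<and> U \<omega> \<le> 1) \<and>
     (\<forall>\<omega>\<in>space N. l1_norm (\<Theta> \<omega>) = 1) \<and>
     measure N {\<omega> \<in> space N. U \<omega> = 0} < 1 \<and>
     measure N {\<omega> \<in> space N. U \<omega> = 1} < 1"

definition P_inf :: "'b measure \<Rightarrow> ('b \<Rightarrow> real) \<Rightarrow> ('b \<Rightarrow> real ^ 'd) \<Rightarrow> (real \<times> (real ^ 'd)) measure"
  where "P_inf N U \<Theta> = distr N borel (\<lambda>\<omega>. (U \<omega>, \<Theta> \<omega>))"

definition P_exc ::
  "'a measure \<Rightarrow> ('a \<Rightarrow> real) \<Rightarrow> ('a \<Rightarrow> real ^ 'd) \<Rightarrow> real \<Rightarrow> (real \<times> (real ^ 'd)) measure" where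
  "P_exc M Y X t = cond_law M {\<omega> \<in> space M. tau (Y \<omega>) (X \<omega>) > t}
     (\<lambda>\<omega>. (U_tilde (Y \<omega>) (X \<omega>), Theta_tilde (X \<omega>)))"

text \<open>The law of \<open>(U, \<Theta>)\<close> is \<open>f(u|\<theta>) du p(d\<theta>)\<close> with \<open>du\<close> Lebesgue measure on \<open>[0,1]\<close>, \<open>p\<close> the law
  of \<open>\<Theta>\<close>, and \<open>f\<close> almost everywhere positive. As \<open>p\<close> is the marginal law, it follows that
  \<open>f(\<cdot>|\<theta>)\<close> is a probability density for \<open>p\<close>-almost all \<open>\<theta>\<close>.\<close>

definition has_positive_cond_density ::
  "'b measure \<Rightarrow> ('b \<Rightarrow> real) \<Rightarrow> ('b \<Rightarrow> real ^ 'd) \<Rightarrow> (real \<Rightarrow> real ^ 'd \<Rightarrow> real) \<Rightarrow> bool" where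
  "has_positive_cond_density N U \<Theta> f \<longleftrightarrow>
     (let \<nu> = density lborel (indicator {0..1}) \<Otimes>\<^sub>M distr N borel \<Theta> in
        (\<lambda>(u, \<theta>). f u \<theta>) \<in> borel_measurable borel \<and>
        P_inf N U \<Theta> = density \<nu> (\<lambda>(u, \<theta>). ennreal (f u \<theta>)) \<and>
        (AE (u, \<theta>) in \<nu>. f u \<theta> > 0))"

end

theory Submission
  imports Defs
begin

text \<open>The total variation distance of product measures is at most the sum of the distances of the
  factors, so the laws of the two samples of size \<open>k\<close> differ by at most \<open>k \<parallel>P\<^sub>t - P\<^sub>\<infinity>\<parallel>\<close>. By independence
  one may condition on \<open>K(n) = k\<close>; off an event of small probability \<open>k\<close> is large and
  \<open>k \<parallel>P\<^sub>t - P\<^sub>\<infinity>\<parallel>\<close> is small, so the conditional probability of a deviation of \<open>T\<^sub>k\<close> is small.\<close>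

section \<open>Total variation norm: order, triangle inequality, images under measurable
  maps\<close>

lemma measure_diff_le_tv_norm:
  assumes "prob_space P" "prob_space Q" "A \<in> sets P"
  shows "\<bar>measure P A - measure Q A\<bar> \<le> tv_norm P Q"
  unfolding tv_norm_def
\<comment> \<open>A supremum of reals dominates its members only if the family is bounded above; for
  two probability measures the bound 1 serves.\<close>
proof (rule cSUP_upper[OF assms(3)], rule bdd_aboveI2[where M = 1])
  fix B
  show "\<bar>measure P B - measure Q B\<bar> \<le> 1"
    using prob_space.prob_le_1[OF assms(1), of B] prob_space.prob_le_1[OF assms(2), of B]
      measure_nonneg[of P B] measure_nonneg[of Q B] by linarith
qed

lemma tv_norm_nonneg:
  assumes "prob_space P" "prob_space Q"
  shows "0 \<le> tv_norm P Q"
  using measure_diff_le_tv_norm[OF assms sets.empty_sets] by simp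

lemma tv_norm_leI:
  assumes "\<And>A. A \<in> sets P \<Longrightarrow> \<bar>measure P A - measure Q A\<bar> \<le> c"
  shows "tv_norm P Q \<le> c"
  unfolding tv_norm_def using assms sets.empty_sets by (blast intro: cSUP_least)

lemma tv_norm_commute:
  assumes "sets P = sets Q"
  shows "tv_norm P Q = tv_norm Q P"
  using assms by (simp add: tv_norm_def abs_minus_commute)

lemma tv_norm_triangle:
  assumes "prob_space P" "prob_space Q" "prob_space R" "sets P = sets Q"
  shows "tv_norm P R \<le> tv_norm P Q + tv_norm Q R"
proof (rule tv_norm_leI)
  fix A assume "A \<in> sets P"
  then show "\<bar>measure P A - measure R A\<bar> \<le> tv_norm P Q + tv_norm Q R"
    using measure_diff_le_tv_norm[of P Q A] measure_diff_le_tv_norm[of Q R A] assms by auto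
qed

text \<open>Every event of the image space pulls back along \<open>h\<close> to an event of the
  original space, so the supremum on the left runs over differences already counted on the
  right.\<close>

lemma tv_norm_distr_le:
  assumes P: "prob_space P" and Q: "prob_space Q" and PQ: "sets P = sets Q"
    and h: "h \<in> measurable P L"
  shows "tv_norm (distr P L h) (distr Q L h) \<le> tv_norm P Q"
proof (rule tv_norm_leI)
  fix A assume A: "A \<in> sets (distr P L h)"
  have h': "h \<in> measurable Q L"
    using h measurable_cong_sets[OF PQ refl] by blast
  have "h -` A \<inter> space P \<in> sets P"
    using A h by (simp add: measurable_sets)
  then show "\<bar>measure (distr P L h) A - measure (distr Q L h) A\<bar> \<le> tv_norm P Q"
    using A measure_diff_le_tv_norm[OF P Q, of "h -` A \<inter> space P"]
    by (simp add: measure_distr[OF h] measure_distr[OF h'] sets_eq_imp_space_eq[OF PQ])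
qed

text \<open>Bridge from extended nonnegative reals to reals: bounds for product measures come from
  nonnegative integrals, where two one-sided inequalities replace the absolute difference.\<close>

lemma tv_norm_leI_emeasure:
  assumes P: "prob_space P" and Q: "prob_space Q" and c: "0 \<le> c"
    and 1: "\<And>A. A \<in> sets P \<Longrightarrow> emeasure P A \<le> emeasure Q A + ennreal c"
    and 2: "\<And>A. A \<in> sets P \<Longrightarrow> emeasure Q A \<le> emeasure P A + ennreal c"
  shows "tv_norm P Q \<le> c"
proof (rule tv_norm_leI)
  interpret P: prob_space P by (rule P)
  interpret Q: prob_space Q by (rule Q)
  fix A assume A: "A \<in> sets P"
  have "measure P A \<le> measure Q A + c" "measure Q A \<le> measure P A + c"
    using 1[OF A] 2[OF A] c
    by (simp_all add: P.emeasure_eq_measure Q.emeasure_eq_measure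
        flip: ennreal_plus)
  then show "\<bar>measure P A - measure Q A\<bar> \<le> c"
    by linarith
qed

lemma emeasure_le_add_tv_norm:
  assumes P: "prob_space P" and Q: "prob_space Q" and A: "A \<in> sets P"
  shows "emeasure P A \<le> emeasure Q A + ennreal (tv_norm P Q)"
proof -
  interpret P: prob_space P by (rule P)
  interpret Q: prob_space Q by (rule Q)
  have "measure P A \<le> measure Q A + tv_norm P Q"
    using measure_diff_le_tv_norm[OF P Q A] by linarith
  then show ?thesis
    using tv_norm_nonneg[OF P Q]
    by (simp add: P.emeasure_eq_measure Q.emeasure_eq_measure
        flip: ennreal_plus)
qed

section \<open>Total variation norm of product measures\<close>

text \<open>Slice an event along the common second coordinate: by Fubini its measure is the
  \<open>R\<close>-integral of the slice measures, and on each slice exchanging \<open>P\<close> and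
  \<open>Q\<close> costs at most \<open>tv_norm P Q\<close>.\<close>

lemma tv_norm_pair_left_le:
  assumes P: "prob_space P" and Q: "prob_space Q" and PQ: "sets P = sets Q" and R: "prob_space R"
  shows "tv_norm (P \<Otimes>\<^sub>M R) (Q \<Otimes>\<^sub>M R) \<le> tv_norm P Q"
proof -
  \<comment> \<open>Kept general in \<open>P\<close> and \<open>Q\<close>, since the reverse
    inequality is the same claim with the two measures exchanged.\<close>
  have le: "emeasure (P \<Otimes>\<^sub>M R) A \<le> emeasure (Q \<Otimes>\<^sub>M R) A + ennreal (tv_norm P Q)"
    if P: "prob_space P" and Q: "prob_space Q" and PQ: "sets P = sets Q"
      and A: "A \<in> sets (P \<Otimes>\<^sub>M R)" for P Q A
  proof -
    interpret P: prob_space P by (rule P)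
    interpret Q: prob_space Q by (rule Q)
    interpret R: prob_space R by (rule R)
    interpret PR: pair_sigma_finite P R ..
    interpret QR: pair_sigma_finite Q R ..
    have A': "A \<in> sets (Q \<Otimes>\<^sub>M R)"
      using A sets_pair_measure_cong[OF PQ refl] by blast
    have "emeasure (P \<Otimes>\<^sub>M R) A = (\<integral>\<^sup>+y. emeasure P ((\<lambda>x. (x, y)) -` A) \<partial>R)"
      by (rule PR.emeasure_pair_measure_alt2[OF A])
    also have "\<dots> \<le> (\<integral>\<^sup>+y. emeasure Q ((\<lambda>x. (x, y)) -` A) + ennreal (tv_norm P Q) \<partial>R)"
      by (intro nn_integral_mono emeasure_le_add_tv_norm P Q sets_Pair2[OF A])
    \<comment> \<open>The additive constant survives the integration unchanged because
      \<open>R\<close> has total mass 1.\<close>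
    also have "\<dots> = emeasure (Q \<Otimes>\<^sub>M R) A + ennreal (tv_norm P Q)"
      using QR.measurable_emeasure_Pair2[OF A']
      by (simp add: nn_integral_add QR.emeasure_pair_measure_alt2[OF A'] R.emeasure_space_1)
    finally show ?thesis .
  qed
  have sets: "sets (P \<Otimes>\<^sub>M R) = sets (Q \<Otimes>\<^sub>M R)"
    by (rule sets_pair_measure_cong[OF PQ refl])
  show ?thesis
  proof (rule tv_norm_leI_emeasure[OF _ _ tv_norm_nonneg[OF P Q]])
    show "prob_space (P \<Otimes>\<^sub>M R)" "prob_space (Q \<Otimes>\<^sub>M R)"
      using P Q R by (auto intro: prob_space_pair)
  next
    fix A assume A: "A \<in> sets (P \<Otimes>\<^sub>M R)"
    show "emeasure (P \<Otimes>\<^sub>M R) A \<le> emeasure (Q \<Otimes>\<^sub>M R) A + ennreal (tv_norm P Q)"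
      by (rule le[OF P Q PQ A])
    show "emeasure (Q \<Otimes>\<^sub>M R) A \<le> emeasure (P \<Otimes>\<^sub>M R) A + ennreal (tv_norm P Q)"
      using le[OF Q P PQ[symmetric], of A] A sets tv_norm_commute[OF PQ] by simp
  qed
qed

text \<open>Swapping the coordinates is a measurable map, and passing to images does not increase
  the distance, so the bound for the left factor carries over.\<close>

lemma tv_norm_pair_right_le:
  assumes P: "prob_space P" and Q: "prob_space Q" and PQ: "sets P = sets Q" and R: "prob_space R"
  shows "tv_norm (R \<Otimes>\<^sub>M P) (R \<Otimes>\<^sub>M Q) \<le> tv_norm P Q"
proof -
  interpret P: prob_space P by (rule P)
  interpret Q: prob_space Q by (rule Q)
  interpret R: prob_space R by (rule R)
  interpret RP: pair_sigma_finite R P ..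
  interpret RQ: pair_sigma_finite R Q ..
  \<comment> \<open>Both images are taken into the same target; for the second one this is harmless
    because \<open>R \<Otimes>\<^sub>M P\<close> and \<open>R \<Otimes>\<^sub>M Q\<close> have the
    same measurable sets.\<close>
  have "tv_norm (R \<Otimes>\<^sub>M P) (R \<Otimes>\<^sub>M Q) =
      tv_norm (distr (P \<Otimes>\<^sub>M R) (R \<Otimes>\<^sub>M P) (\<lambda>(x, y). (y, x)))
        (distr (Q \<Otimes>\<^sub>M R) (R \<Otimes>\<^sub>M P) (\<lambda>(x, y). (y, x)))"
    using RP.distr_pair_swap RQ.distr_pair_swap
      distr_cong[OF refl sets_pair_measure_cong[OF refl PQ] refl, of "Q \<Otimes>\<^sub>M R" R "\<lambda>(x, y). (y, x)"]
    by simp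
  also have "\<dots> \<le> tv_norm (P \<Otimes>\<^sub>M R) (Q \<Otimes>\<^sub>M R)"
    using P Q R PQ
    by (intro tv_norm_distr_le prob_space_pair sets_pair_measure_cong measurable_pair_swap' refl)
  also have "\<dots> \<le> tv_norm P Q"
    by (rule tv_norm_pair_left_le[OF P Q PQ R])
  finally show ?thesis .
qed

text \<open>Change one factor at a time, passing through the intermediate product of
  \<open>P'\<close> and \<open>Q\<close>.\<close>

lemma tv_norm_pair_le:
  assumes "prob_space P" "prob_space P'" "sets P = sets P'"
    and "prob_space Q" "prob_space Q'" "sets Q = sets Q'"
  shows "tv_norm (P \<Otimes>\<^sub>M Q) (P' \<Otimes>\<^sub>M Q') \<le> tv_norm P P' + tv_norm Q Q'"
proof -
  have "tv_norm (P \<Otimes>\<^sub>M Q) (P' \<Otimes>\<^sub>M Q') \<le>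
      tv_norm (P \<Otimes>\<^sub>M Q) (P' \<Otimes>\<^sub>M Q) + tv_norm (P' \<Otimes>\<^sub>M Q) (P' \<Otimes>\<^sub>M Q')"
    using assms by (intro tv_norm_triangle prob_space_pair sets_pair_measure_cong refl)
  then show ?thesis
    using tv_norm_pair_left_le[OF assms(1-4)] tv_norm_pair_right_le[OF assms(4-6,2)] by linarith
qed

text \<open>Induction on the index set: the product over \<open>insert i I\<close> is the image of a
  binary product under \<open>X(i := x)\<close>, so each new index contributes one summand through
  the binary bound.\<close>

lemma tv_norm_PiM_le:
  assumes P: "\<And>i. i \<in> I \<Longrightarrow> prob_space (P i)" and Q: "\<And>i. i \<in> I \<Longrightarrow> prob_space (Q i)"
    and PQ: "\<And>i. i \<in> I \<Longrightarrow> sets (P i) = sets (Q i)" and "finite I"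
  shows "tv_norm (PiM I P) (PiM I Q) \<le> (\<Sum>i\<in>I. tv_norm (P i) (Q i))"
  using \<open>finite I\<close> P Q PQ
proof (induction I)
  case empty
  \<comment> \<open>Both empty products are the counting measure on the same one-point space, so all
    differences vanish.\<close>
  show ?case by (rule tv_norm_leI) (simp add: PiM_empty)
next
  case (insert i I)
  let ?L = "PiM (insert i I) P" and ?h = "\<lambda>(x, X). X(i := x)"
  have prob: "prob_space (PiM I P)" "prob_space (PiM I Q)"
    using insert.prems by (auto intro: prob_space_PiM)
  have sets: "sets (PiM I P) = sets (PiM I Q)" "sets ?L = sets (PiM (insert i I) Q)"
    using insert.prems by (auto intro!: sets_PiM_cong)
  have eq: "distr (P i \<Otimes>\<^sub>M PiM I P) ?L ?h = ?L" "distr (Q i \<Otimes>\<^sub>M PiM I Q) ?L ?h = PiM (insert i I) Q"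
    using distr_pair_PiM_eq_PiM[of I P i] distr_pair_PiM_eq_PiM[of I Q i] insert.prems
      distr_cong[OF refl sets(2) refl, of "Q i \<Otimes>\<^sub>M PiM I Q" ?h]
    by auto
  have h: "?h \<in> measurable (P i \<Otimes>\<^sub>M PiM I P) ?L"
    unfolding split_beta' by (rule measurable_fun_upd[where J = I]) auto
  have "tv_norm ?L (PiM (insert i I) Q) =
      tv_norm (distr (P i \<Otimes>\<^sub>M PiM I P) ?L ?h) (distr (Q i \<Otimes>\<^sub>M PiM I Q) ?L ?h)"
    by (simp only: eq)
  also have "\<dots> \<le> tv_norm (P i \<Otimes>\<^sub>M PiM I P) (Q i \<Otimes>\<^sub>M PiM I Q)"
    using insert.prems prob sets h
    by (intro tv_norm_distr_le prob_space_pair sets_pair_measure_cong) auto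
  also have "\<dots> \<le> tv_norm (P i) (Q i) + tv_norm (PiM I P) (PiM I Q)"
    using insert.prems prob sets by (intro tv_norm_pair_le) auto
  also have "\<dots> \<le> tv_norm (P i) (Q i) + (\<Sum>i\<in>I. tv_norm (P i) (Q i))"
    using insert.IH insert.prems by simp
  finally show ?case
    using insert.hyps by simp
qed

section \<open>Laws of finite iid samples\<close>

lemma iid_from_prob_space:
  assumes "prob_space S" "iid_from S P V"
  shows "prob_space P" "sets P = sets borel"
proof -
  interpret S: prob_space S by (rule assms(1))
  have "V 0 \<in> borel_measurable S" "distr S borel (V 0) = P"
    using assms(2) by (auto simp: iid_from_def S.indep_vars_def)
  then show "prob_space P" "sets P = sets borel"
    using S.prob_space_distr by auto
qed

lemma iid_from_distr:
  assumes "prob_space S" "iid_from S P V" "k > 0"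
  shows "distr S (\<Pi>\<^sub>M i\<in>{..<k}. borel) (\<lambda>\<omega>. \<lambda>i\<in>{..<k}. V i \<omega>) = (\<Pi>\<^sub>M i\<in>{..<k}. P)"
proof -
  interpret S: prob_space S by (rule assms(1))
  have V: "S.indep_vars (\<lambda>_. borel) V UNIV" and P: "\<And>i. distr S borel (V i) = P"
    using assms(2) by (auto simp: iid_from_def)
  have rv: "\<And>i. V i \<in> borel_measurable S"
    using V by (auto simp: S.indep_vars_def)
  have "S.indep_vars (\<lambda>_. borel) V {..<k}"
    by (rule S.indep_vars_subset[OF V]) simp
  \<comment> \<open>Joint independence amounts to the joint law being the product of the marginals;
    \<open>k > 0\<close> provides the nonempty index set that this characterisation asks
    for.\<close>
  then show ?thesis
    using S.indep_vars_iff_distr_eq_PiM[where I = "{..<k}" and M' = "\<lambda>_. borel" and X = V] rv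
      assms(3) P by auto
qed

lemma iid_from_measurable_restrict:
  assumes "prob_space S" "iid_from S P V"
  shows "(\<lambda>\<omega>. \<lambda>i\<in>{..<k}. V i \<omega>) \<in> measurable S (\<Pi>\<^sub>M i\<in>{..<k}. borel)"
  using assms by (intro measurable_restrict) (auto simp: iid_from_def prob_space.indep_vars_def)

text \<open>The two samples enter only through their laws, the \<open>k\<close>-fold powers of
  \<open>P\<close> and \<open>Q\<close>; the product bound then adds up \<open>k\<close> equal
  terms.\<close>

lemma iid_from_measure_diff_le:
  assumes S: "prob_space S" and V: "iid_from S P V" and W: "iid_from S Q W" and k: "k > 0"
    and A: "A \<in> sets (\<Pi>\<^sub>M i\<in>{..<k}. borel)"
  shows "measure S {\<omega> \<in> space S. (\<lambda>i\<in>{..<k}. W i \<omega>) \<in> A}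
    \<le> measure S {\<omega> \<in> space S. (\<lambda>i\<in>{..<k}. V i \<omega>) \<in> A} + real k * tv_norm Q P"
proof -
  note P = iid_from_prob_space[OF S V] and Q = iid_from_prob_space[OF S W]
  have *: "measure S {\<omega> \<in> space S. (\<lambda>i\<in>{..<k}. Z i \<omega>) \<in> A} = measure (\<Pi>\<^sub>M i\<in>{..<k}. R) A"
    if Z: "iid_from S R Z" for R Z
    unfolding iid_from_distr[OF S Z k, symmetric]
    using iid_from_measurable_restrict[OF S Z] A
    by (auto simp: measure_distr intro!: arg_cong[where f = "measure S"])
  have sets: "A \<in> sets (\<Pi>\<^sub>M i\<in>{..<k}. Q)"
    using A sets_PiM_cong[of "{..<k}" "{..<k}" "\<lambda>_. borel" "\<lambda>_. Q"] Q(2) by simp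
  have "\<bar>measure (\<Pi>\<^sub>M i\<in>{..<k}. Q) A - measure (\<Pi>\<^sub>M i\<in>{..<k}. P) A\<bar>
      \<le> tv_norm (\<Pi>\<^sub>M i\<in>{..<k}. Q) (\<Pi>\<^sub>M i\<in>{..<k}. P)"
    using P Q sets by (intro measure_diff_le_tv_norm prob_space_PiM)
  also have "\<dots> \<le> real k * tv_norm Q P"
    using tv_norm_PiM_le[of "{..<k}" "\<lambda>_. Q" "\<lambda>_. P"] P Q by simp
  finally show ?thesis
    unfolding *[OF V] *[OF W] by linarith
qed

section \<open>Random indices and independence\<close>

text \<open>Total probability: the events \<open>K = k\<close> partition the space, so a bound
  \<open>c\<close> valid conditionally on each admissible value of \<open>K\<close> is averaged with
  weights of sum at most 1.\<close>

lemma (in prob_space) prob_random_index_le: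
  fixes K :: "'a \<Rightarrow> nat"
  assumes E: "\<And>k. k \<in> G \<Longrightarrow> {\<omega> \<in> space M. K \<omega> = k} \<inter> E k \<in> events"
    and K: "K \<in> measurable M (count_space UNIV)"
    and le: "\<And>k. k \<in> G \<Longrightarrow> prob ({\<omega> \<in> space M. K \<omega> = k} \<inter> E k)
        \<le> prob {\<omega> \<in> space M. K \<omega> = k} * c"
    and c: "0 \<le> c"
  shows "prob (\<Union>k\<in>G. {\<omega> \<in> space M. K \<omega> = k} \<inter> E k) \<le> c"
proof -
  let ?B = "\<lambda>k. {\<omega> \<in> space M. K \<omega> = k}"
  \<comment> \<open>Padding with the empty set outside \<open>G\<close> turns the union over
    \<open>G\<close> into a series over all naturals, to be compared termwise with the series of the
    weights.\<close>
  define A where "A k = (if k \<in> G then ?B k \<inter> E k else {})" for k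
  have B: "?B k \<in> events" for k
    using measurable_sets[OF K, of "{k}"] by (simp add: vimage_def Int_def conj_commute)
  have "(\<lambda>k. prob (A k)) sums prob (\<Union>k. A k)"
  proof (rule finite_measure_UNION)
    show "range A \<subseteq> events"
      using E by (auto simp: A_def)
    show "disjoint_family A"
      by (auto simp: A_def disjoint_family_on_def)
  qed
  moreover have "(\<lambda>k. prob (?B k)) sums prob (\<Union>k. ?B k)"
    using B by (intro finite_measure_UNION) (auto simp: disjoint_family_on_def)
  moreover have "(\<Union>k. ?B k) = space M"
    by auto
  ultimately have sums: "(\<lambda>k. prob (A k)) sums prob (\<Union>k. A k)" "(\<lambda>k. prob (?B k)) sums 1"
    by (simp_all add: prob_space)
  have "prob (A k) \<le> prob (?B k) * c" for k
    using le[of k] c by (simp add: A_def)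
  from sums_le[OF this sums(1) sums_mult2[OF sums(2)]] have "prob (\<Union>k. A k) \<le> c"
    by simp
  moreover have "(\<Union>k\<in>G. ?B k \<inter> E k) = (\<Union>k. A k)"
    by (auto simp: A_def split: if_splits)
  ultimately show ?thesis
    by simp
qed

text \<open>Preimages of measurable sets belong to the generated \<sigma>-algebras, so independence
  of these yields the product rule.\<close>

lemma indep_rv_prob:
  assumes S: "prob_space S" and "indep_rv S N Z N' Z'" "A \<in> sets N" "B \<in> sets N'"
  shows "measure S ({\<omega> \<in> space S. Z \<omega> \<in> A} \<inter> {\<omega> \<in> space S. Z' \<omega> \<in> B})
    = measure S {\<omega> \<in> space S. Z \<omega> \<in> A} * measure S {\<omega> \<in> space S. Z' \<omega> \<in> B}"
proof -
  interpret S: prob_space S by (rule S)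
  have indep: "S.indep_set (sets (vimage_algebra (space S) Z N)) (sets (vimage_algebra (space S) Z' N'))"
    using assms(2) by (simp add: indep_rv_def)
  have "{\<omega> \<in> space S. Z \<omega> \<in> A} \<in> sets (vimage_algebra (space S) Z N)"
    "{\<omega> \<in> space S. Z' \<omega> \<in> B} \<in> sets (vimage_algebra (space S) Z' N')"
    using in_vimage_algebra[OF assms(3), of Z "space S"] in_vimage_algebra[OF assms(4), of Z' "space S"]
    by (simp_all add: vimage_def Int_def conj_commute)
  then show ?thesis
    by (rule S.indep_setD[OF indep])
qed

section \<open>Convergence in probability at the random sample size\<close>

theorem proposition4p2:
  fixes M :: "'a measure" and Y :: "'a \<Rightarrow> real" and X :: "'a \<Rightarrow> real ^ 'd"
    and N :: "'b measure" and U :: "'b \<Rightarrow> real" and \<Theta> :: "'b \<Rightarrow> real ^ 'd"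
    and f :: "real \<Rightarrow> real ^ 'd \<Rightarrow> real"
    and t :: "nat \<Rightarrow> real"
    and S :: "'s measure"
    and V :: "nat \<Rightarrow> 's \<Rightarrow> real \<times> (real ^ 'd)"
    and W :: "nat \<Rightarrow> nat \<Rightarrow> 's \<Rightarrow> real \<times> (real ^ 'd)"
    and K :: "nat \<Rightarrow> 's \<Rightarrow> nat"
    and T :: "nat \<Rightarrow> (nat \<Rightarrow> real \<times> (real ^ 'd)) \<Rightarrow> 'e::euclidean_space"
  assumes "prob_space M" and "Y \<in> borel_measurable M" and "X \<in> borel_measurable M"
    and "\<forall>\<omega>\<in>space M. Y \<omega> \<ge> 0"
    and "prob_space N" and "U \<in> borel_measurable N" and "\<Theta> \<in> borel_measurable N"
    and "jointly_regularly_varying M Y X N U \<Theta>"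
    and "has_positive_cond_density N U \<Theta> f"
    and "filterlim t at_top sequentially"
    and "prob_space S"
    and "iid_from S (P_inf N U \<Theta>) V"
    and "\<forall>n. iid_from S (P_exc M Y X (t n)) (W n)"
    and "\<forall>n. indep_rv S (count_space UNIV) (K n)
           ((\<Pi>\<^sub>M i\<in>UNIV. borel) \<Otimes>\<^sub>M (\<Pi>\<^sub>M i\<in>UNIV. borel))
           (\<lambda>\<omega>. (\<lambda>i. V i \<omega>, \<lambda>i. W n i \<omega>))"
    and "infinity_in_prob S K"
    and "conv_in_prob S
           (\<lambda>n \<omega>. real (K n \<omega>) * tv_norm (P_exc M Y X (t n)) (P_inf N U \<Theta>)) 0"
    and "\<forall>k. T k \<in> borel_measurable (\<Pi>\<^sub>M i\<in>{..<k}. borel)"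
    and "conv_in_prob S (\<lambda>k \<omega>. T k (\<lambda>i\<in>{..<k}. V i \<omega>)) 0"
  shows "conv_in_prob S (\<lambda>n \<omega>. T (K n \<omega>) (\<lambda>i\<in>{..<K n \<omega>}. W n i \<omega>)) 0"
proof -
  interpret S: prob_space S by (rule assms(11))
  let ?tv = "\<lambda>n. tv_norm (P_exc M Y X (t n)) (P_inf N U \<Theta>)"
  note iidV = assms(12) and iidW = assms(13)[rule_format] and indep = assms(14)[rule_format]
    and T = assms(17)[rule_format]
  have K: "K n \<in> measurable S (count_space UNIV)" for n
    using indep[of n] by (simp add: indep_rv_def)
  have K_set: "{\<omega> \<in> space S. Q (K n \<omega>)} \<in> sets S" for n Q
    using measurable_sets[OF K, of "Collect Q" n] by (simp add: vimage_def Int_def conj_commute)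
  show ?thesis
    unfolding conv_in_prob_def
  proof (intro allI impI)
    fix e :: real assume e: "e > 0"
    \<comment> \<open>The deviation is recorded as a set of samples of size \<open>k\<close>, so
      that the same set can be tested on \<open>V\<close> and on \<open>W n\<close>.\<close>
    define A where "A k = {x \<in> space (\<Pi>\<^sub>M i\<in>{..<k}. borel). dist (T k x) 0 > e}" for k
    define E where "E n k = {\<omega> \<in> space S. (\<lambda>i\<in>{..<k}. W n i \<omega>) \<in> A k}" for n k
    have A: "A k \<in> sets (\<Pi>\<^sub>M i\<in>{..<k}. borel)" for k
      unfolding A_def using T[of k] by measurable
    have in_A: "(\<lambda>i\<in>{..<k}. x i) \<in> A k \<longleftrightarrow> dist (T k (\<lambda>i\<in>{..<k}. x i)) 0 > e" for k x
      by (simp add: A_def space_PiM)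
    have E: "E n k \<in> sets S" for n k
      using measurable_sets[OF iid_from_measurable_restrict[OF assms(11) iidW[of n], of k] A[of k]]
      by (simp add: E_def vimage_def Int_def conj_commute)
    have prob_E: "S.prob ({\<omega> \<in> space S. K n \<omega> = k} \<inter> E n k)
        = S.prob {\<omega> \<in> space S. K n \<omega> = k} * S.prob (E n k)" for n k
    proof -
      \<comment> \<open>Independence is assumed for the pair of whole sequences; the event
        \<open>E n k\<close> is the preimage under that pair of a set depending only on the first
        \<open>k\<close> coordinates of the second sequence.\<close>
      let ?B = "(\<lambda>(v :: nat \<Rightarrow> real \<times> (real ^ 'd), w). \<lambda>i\<in>{..<k}. w i) -` A k \<inter>
        space ((\<Pi>\<^sub>M i\<in>UNIV. borel) \<Otimes>\<^sub>M (\<Pi>\<^sub>M i\<in>UNIV. borel))"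
      have "?B \<in> sets ((\<Pi>\<^sub>M i\<in>UNIV. borel) \<Otimes>\<^sub>M (\<Pi>\<^sub>M i\<in>UNIV. borel))"
        by (rule measurable_sets[OF _ A]) measurable
      from indep_rv_prob[OF assms(11) indep _ this, of "{k}"] show ?thesis
        by (simp add: E_def space_pair_measure space_PiM)
    qed
    show "(\<lambda>n. S.prob {\<omega> \<in> space S. dist (T (K n \<omega>) (\<lambda>i\<in>{..<K n \<omega>}. W n i \<omega>)) 0 > e}) \<longlonglongrightarrow> 0"
    proof (rule LIMSEQ_I)
      fix r :: real assume r: "r > 0"
      \<comment> \<open>The union bound below collects \<open>d\<close> from \<open>?D1\<close>,
        \<open>d\<close> from \<open>?D2\<close> and \<open>2 * d\<close> from \<open>?D3\<close>,
        and \<open>4 * d < r\<close>.\<close>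
      define d where "d = r / 5"
      have d: "d > 0" using r by (simp add: d_def)
      have "(\<lambda>k. S.prob {\<omega> \<in> space S. (\<lambda>i\<in>{..<k}. V i \<omega>) \<in> A k}) \<longlonglongrightarrow> 0"
        using assms(18) e by (simp add: conv_in_prob_def in_A)
      from order_tendstoD(2)[OF this d] obtain m
        where m: "\<And>k. k \<ge> m \<Longrightarrow> S.prob {\<omega> \<in> space S. (\<lambda>i\<in>{..<k}. V i \<omega>) \<in> A k} < d"
        by (auto simp: eventually_sequentially)
      \<comment> \<open>\<open>Suc m\<close> instead of \<open>m\<close> keeps the sample size
        positive even for \<open>m = 0\<close>, as the comparison of the two samples
        requires.\<close>
      have "\<forall>\<^sub>F n in sequentially. S.prob {\<omega> \<in> space S. K n \<omega> \<ge> Suc m} > 1 - d"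
        using assms(15) d by (auto simp: infinity_in_prob_def intro!: order_tendstoD(1))
      moreover have "\<forall>\<^sub>F n in sequentially.
          S.prob {\<omega> \<in> space S. dist (real (K n \<omega>) * ?tv n) 0 > d} < d"
        using assms(16) d by (auto simp: conv_in_prob_def intro!: order_tendstoD(2))
      ultimately have "\<forall>\<^sub>F n in sequentially.
          S.prob {\<omega> \<in> space S. dist (T (K n \<omega>) (\<lambda>i\<in>{..<K n \<omega>}. W n i \<omega>)) 0 > e} < r"
      proof eventually_elim
        case (elim n)
        \<comment> \<open>\<open>?G\<close> holds the good sample sizes: large enough for
          \<open>T k\<close> on the \<open>V\<close> sample, small enough for the total variation
          error. \<open>K n\<close> leaves \<open>?G\<close> only on \<open>?D1\<close> or
          \<open>?D2\<close>; \<open>?D3\<close> is a deviation at a good size.\<close>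
        let ?G = "{k. k \<ge> Suc m \<and> dist (real k * ?tv n) 0 \<le> d}"
        let ?D1 = "{\<omega> \<in> space S. \<not> K n \<omega> \<ge> Suc m}"
        let ?D2 = "{\<omega> \<in> space S. dist (real (K n \<omega>) * ?tv n) 0 > d}"
        let ?D3 = "\<Union>k\<in>?G. {\<omega> \<in> space S. K n \<omega> = k} \<inter> E n k"
        have sets: "?D1 \<in> sets S" "?D2 \<in> sets S" "?D3 \<in> sets S"
          using E[of n] by (auto intro!: K_set sets.countable_UN'')
        have "S.prob ?D1 < d"
          using elim(1) S.prob_neg[OF K_set[of "\<lambda>k. k \<ge> Suc m" n]] by simp
        moreover have "S.prob ?D3 \<le> 2 * d"
        proof (rule S.prob_random_index_le[OF _ K])
          fix k assume k: "k \<in> ?G"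
          show "{\<omega> \<in> space S. K n \<omega> = k} \<inter> E n k \<in> sets S"
            using E[of n k] by (auto intro!: K_set)
          have "S.prob (E n k) \<le> S.prob {\<omega> \<in> space S. (\<lambda>i\<in>{..<k}. V i \<omega>) \<in> A k} + real k * ?tv n"
            unfolding E_def using k
            by (intro iid_from_measure_diff_le[OF assms(11) iidV iidW _ A]) auto
          \<comment> \<open>One \<open>d\<close> bounds the deviation for the limit law, the other
            the cost of replacing that law by \<open>P_exc\<close>.\<close>
          also have "\<dots> \<le> 2 * d"
            using m[of k] k by (auto simp: dist_real_def)
          finally show "S.prob ({\<omega> \<in> space S. K n \<omega> = k} \<inter> E n k)
              \<le> S.prob {\<omega> \<in> space S. K n \<omega> = k} * (2 * d)"
            unfolding prob_E by (intro mult_left_mono) auto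
        qed (use d in auto)
        moreover have "S.prob {\<omega> \<in> space S. dist (T (K n \<omega>) (\<lambda>i\<in>{..<K n \<omega>}. W n i \<omega>)) 0 > e}
            \<le> S.prob (?D1 \<union> ?D2 \<union> ?D3)"
        proof (rule S.finite_measure_mono)
          show "{\<omega> \<in> space S. dist (T (K n \<omega>) (\<lambda>i\<in>{..<K n \<omega>}. W n i \<omega>)) 0 > e}
              \<subseteq> ?D1 \<union> ?D2 \<union> ?D3"
            \<comment> \<open>Outside \<open>?D1\<close> and \<open>?D2\<close> the value
              \<open>K n \<omega>\<close> itself lies in \<open>?G\<close> and serves as the index
              \<open>k\<close> in \<open>?D3\<close>.\<close>
            by (auto simp: E_def in_A not_less)
        qed (use sets in auto)
        moreover have "S.prob (?D1 \<union> ?D2 \<union> ?D3) \<le> S.prob ?D1 + S.prob ?D2 + S.prob ?D3"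
          using measure_Un_le[of "?D1 \<union> ?D2" S ?D3] measure_Un_le[of ?D1 S ?D2] sets
          by auto
        ultimately show ?case
          using elim(2) d by (simp add: d_def)
      qed
      then show "\<exists>no. \<forall>n\<ge>no.
          norm (S.prob {\<omega> \<in> space S. dist (T (K n \<omega>) (\<lambda>i\<in>{..<K n \<omega>}. W n i \<omega>)) 0 > e} - 0) < r"
        by (simp add: eventually_sequentially)
    qed
  qed
qed

end
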